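(* Let $c,\alpha,\beta,\gamma\in\mathbb{C}$ with $\Re(c)>\Re(\gamma)>0$, $\Re(\alpha)>0$ and $\Re(\beta)>0$, and let $p,q\ge 0$. Then for every $z\in\mathbb{C}$, $$E_{\alpha,\beta}^{\gamma,c}(z;p,q)=\frac{1}{B(\gamma,c-\gamma)}\int_0^1 t^{\gamma-1}(1-t)^{c-\gamma-1}\exp\Big(-\frac{p}{t}-\frac{q}{1-t}\Big)E_{\alpha,\beta}^{c}(tz)\,dt.$$
   Context: $B(x,y)$ is the classical beta function and $(c)_n=c(c+1)\cdots(c+n-1)$, $(c)_0=1$, is the Pochhammer symbol. The extended beta function is $B(x,y;p,q)=\int_0^1 t^{x-1}(1-t)^{y-1}\exp\big(-\frac{p}{t}-\frac{q}{1-t}\big)\,dt$ for $\Re(x)>0$, $\Re(y)>0$ and $p,q\ge0$; for $p=q=0$ it is the classical beta function. The extended $(p,q)$-Mittag-Leffler function is, for $p,q\ge 0$ and $\Re(c)>\Re(\gamma)>0$, $$E_{\alpha,\beta}^{\gamma,c}(z;p,q)=\sum_{n=0}^{\infty}\frac{B(\gamma+n,c-\gamma;p,q)}{B(\gamma,c-\gamma)}\frac{(c)_n}{\Gamma(\alpha n+\beta)}\frac{z^n}{n!}.$$ The Prabhakar Mittag-Leffler function is $E_{\alpha,\beta}^{c}(z)=\sum_{n=0}^{\infty}\frac{(c)_n}{\Gamma(\alpha n+\beta)}\frac{z^n}{n!}$ for $\Re(\alpha)>0$. *)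

theory Defs
  imports "HOL-Analysis.Analysis"
begin

text \<open>
  The complex powers are principal values, and their bases are positive reals on the open interval.
  The classical beta function is the library's \<^const>\<open>Beta\<close>.
\<close>

definition ext_Beta :: "complex \<Rightarrow> complex \<Rightarrow> real \<Rightarrow> real \<Rightarrow> complex" where
  "ext_Beta x y p q =
     (LINT t:{0<..<1}|lborel.
        complex_of_real t powr (x - 1) * complex_of_real (1 - t) powr (y - 1) *
        complex_of_real (exp (- (p / t) - q / (1 - t))))"

definition prabhakar_ML :: "complex \<Rightarrow> complex \<Rightarrow> complex \<Rightarrow> complex \<Rightarrow> complex" where
  "prabhakar_ML \<alpha> \<beta> c z =
     (\<Sum>n. pochhammer c n / Gamma (\<alpha> * of_nat n + \<beta>) * (z ^ n / fact n))"

definition ext_ML ::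
  "complex \<Rightarrow> complex \<Rightarrow> complex \<Rightarrow> complex \<Rightarrow> complex \<Rightarrow> real \<Rightarrow> real \<Rightarrow> complex" where
  "ext_ML \<alpha> \<beta> \<gamma> c z p q =
     (\<Sum>n. ext_Beta (\<gamma> + of_nat n) (c - \<gamma>) p q / Beta \<gamma> (c - \<gamma>) *
          (pochhammer c n / Gamma (\<alpha> * of_nat n + \<beta>)) * (z ^ n / fact n))"

end

theory Submission
  imports Defs
begin

text \<open>
  The integrand of the extended beta function with first argument \<open>\<gamma> + n\<close> is \<open>t ^ n\<close> times the one with
  first argument \<open>\<gamma>\<close>. The identity therefore says that the Prabhakar series at \<open>t z\<close>, a power series
  in \<open>t\<close>, may be integrated term by term against the weight
  \<open>t powr (\<gamma> - 1) * (1 - t) powr (c - \<gamma> - 1) * exp (- p / t - q / (1 - t))\<close>.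

  The exponential factor is at most \<open>1\<close>, so the classical real beta integrand dominates the weight,
  which is thus integrable (\<open>set_integrable_ext_Beta\<close>). As \<open>0 < t < 1\<close>, dominated convergence gives the
  interchange (\<open>set_integral_power_series_sums\<close>) once the Prabhakar series converges absolutely at the
  point \<open>z\<close> itself (\<open>summable_norm_prabhakar_ML\<close>).

  This convergence holds at every \<open>z\<close> because \<open>1 / \<Gamma>(\<alpha> n + \<beta>)\<close> decays faster than every geometric
  sequence, whereas \<open>(c)\<^sub>n / n!\<close> grows at most geometrically. For complex \<open>\<alpha>\<close> the arguments
  \<open>\<alpha> n + \<beta>\<close> leave the real axis, but they stay in a sector
  \<open>\<bar>Im w\<bar> \<le> K * Re w\<close> of the right half-plane. There, Stirling's formula can be
  avoided: comparing Gauss's products for \<open>1 / \<Gamma>\<close> at \<open>w\<close> and at \<open>Re w\<close> factor by factor shows that passing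
  from \<open>w\<close> to \<open>Re w\<close> costs a factor that is only exponential in \<open>Re w\<close>
  (\<open>norm_rGamma_le_rGamma_Re\<close>), and on the real axis Euler's integral shows that \<open>\<Gamma>\<close> outgrows every
  exponential (\<open>Gamma_ge_powr\<close>).
\<close>

section \<open>Decay of the reciprocal Gamma function in a sector\<close>

text \<open>
  One factor of Gauss's product:
  \<open>\<bar>x + n + i y\<bar>\<^sup>2 = (x + n)\<^sup>2 (1 + y\<^sup>2 / (x + n)\<^sup>2)\<close>, and
  \<open>1 + u \<le> exp u\<close>.
\<close>

lemma norm_add_of_nat_le:
  fixes z :: complex
  assumes "Re z > 0"
  shows "norm (z + of_nat n) \<le> (Re z + real n) * exp ((Im z)\<^sup>2 / 2 * (1 / (Re z + real n)\<^sup>2))"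
proof (rule power2_le_imp_le)
  define x where "x = Re z + real n"
  have x: "x > 0"
    using assms by (simp add: x_def)
  have "(norm (z + of_nat n))\<^sup>2 = x\<^sup>2 + (Im z)\<^sup>2"
    by (simp add: cmod_power2 x_def)
  also have "\<dots> = x\<^sup>2 * (1 + (Im z)\<^sup>2 / x\<^sup>2)"
    using x by (simp add: field_simps)
  also have "\<dots> \<le> x\<^sup>2 * exp ((Im z)\<^sup>2 / x\<^sup>2)"
    by (intro mult_left_mono exp_ge_add_one_self) auto
  also have "\<dots> = (x * exp ((Im z)\<^sup>2 / 2 * (1 / x\<^sup>2)))\<^sup>2"
    by (simp add: power_mult_distrib flip: exp_double)
  finally show "(norm (z + of_nat n))\<^sup>2 \<le>
      ((Re z + real n) * exp ((Im z)\<^sup>2 / 2 * (1 / (Re z + real n)\<^sup>2)))\<^sup>2"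
    by (simp add: x_def)
qed (use assms in auto)

text \<open>
  Multiplying the bounds for the factors \<open>0, \<dots>, n\<close> puts \<open>\<Sum>k\<le>n. 1 / (x + k)\<^sup>2\<close> into the exponent, where
  \<open>x = Re z\<close>. The terms with \<open>k \<ge> 1\<close> are at most \<open>1 / (x + k - 1) - 1 / (x + k)\<close>, which telescopes. The
  subtracted \<open>1 / (x + n)\<close> is what makes the induction go through.
\<close>

lemma norm_pochhammer_le:
  fixes z :: complex
  assumes "Re z > 0"
  shows "norm (pochhammer z (Suc n)) \<le> pochhammer (Re z) (Suc n) *
           exp ((Im z)\<^sup>2 / 2 * (1 / (Re z)\<^sup>2 + 1 / Re z - 1 / (Re z + real n)))"
proof (induction n)
  case 0
  show ?case
    using norm_add_of_nat_le[OF assms, of 0] by simp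
next
  case (Suc n)
  define x y where "x = Re z" and "y = (Im z)\<^sup>2 / 2"
  define u where "u = x + real n"
  have u: "u > 0" and x: "x > 0" and y: "y \<ge> 0"
    using assms by (auto simp: u_def x_def y_def)
  have telescope: "1 / (u + 1)\<^sup>2 \<le> 1 / u - 1 / (u + 1)"
    using u by (simp add: divide_simps power2_eq_square)
  have "norm (pochhammer z (Suc (Suc n))) = norm (pochhammer z (Suc n)) * norm (z + of_nat (Suc n))"
    by (simp add: pochhammer_Suc[of z "Suc n"] norm_mult)
  also have "\<dots> \<le> (pochhammer x (Suc n) * exp (y * (1 / x\<^sup>2 + 1 / x - 1 / u))) *
      ((u + 1) * exp (y * (1 / (u + 1)\<^sup>2)))"
    using Suc.IH norm_add_of_nat_le[OF assms, of "Suc n"] assms u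
    by (intro mult_mono) (auto simp: x_def y_def u_def add_ac
        intro!: mult_nonneg_nonneg less_imp_le[OF pochhammer_pos])
  also have "\<dots> = pochhammer x (Suc n) * (u + 1) *
      exp (y * (1 / x\<^sup>2 + 1 / x - 1 / u + 1 / (u + 1)\<^sup>2))"
    by (simp add: exp_add [symmetric] algebra_simps)
  also have "\<dots> \<le> pochhammer x (Suc n) * (u + 1) *
      exp (y * (1 / x\<^sup>2 + 1 / x - 1 / (u + 1)))"
    using telescope u x y
    by (intro mult_left_mono)
       (auto intro!: mult_left_mono mult_nonneg_nonneg less_imp_le[OF pochhammer_pos])
  also have "pochhammer x (Suc n) * (u + 1) = pochhammer x (Suc (Suc n))"
    by (simp add: pochhammer_Suc[of x "Suc n"] u_def add_ac)
  finally show ?case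
    by (simp add: x_def y_def u_def add_ac)
qed

lemma norm_rGamma_le_rGamma_Re:
  fixes z :: complex
  assumes "Re z > 0"
  shows "norm (rGamma z) \<le> rGamma (Re z) * exp ((Im z)\<^sup>2 / 2 * (1 / (Re z)\<^sup>2 + 1 / Re z))"
proof (rule LIMSEQ_le)
  let ?E = "exp ((Im z)\<^sup>2 / 2 * (1 / (Re z)\<^sup>2 + 1 / Re z))"
  show "(\<lambda>n. norm (rGamma_series z n)) \<longlonglongrightarrow> norm (rGamma z)"
    by (intro tendsto_norm rGamma_series_LIMSEQ)
  show "(\<lambda>n. rGamma_series (Re z) n * ?E) \<longlonglongrightarrow> rGamma (Re z) * ?E"
    by (intro tendsto_mult_right rGamma_series_LIMSEQ)
  have "norm (rGamma_series z n) \<le> rGamma_series (Re z) n * ?E" for n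
  proof -
    let ?d = "fact n * exp (Re z * ln (real n))"
    have "norm (rGamma_series z n) = norm (pochhammer z (Suc n)) / ?d"
      by (simp add: rGamma_series_def norm_divide norm_mult)
    also have "\<dots> \<le> (pochhammer (Re z) (Suc n) *
        exp ((Im z)\<^sup>2 / 2 * (1 / (Re z)\<^sup>2 + 1 / Re z - 1 / (Re z + real n)))) / ?d"
      by (intro divide_right_mono norm_pochhammer_le assms) auto
    also have "\<dots> \<le> (pochhammer (Re z) (Suc n) * ?E) / ?d"
      using assms
      by (intro divide_right_mono mult_left_mono)
         (auto intro!: mult_left_mono less_imp_le[OF pochhammer_pos])
    finally show ?thesis
      by (simp add: rGamma_series_def)
  qed
  then show "\<exists>N. \<forall>n\<ge>N. norm (rGamma_series z n) \<le> rGamma_series (Re z) n * ?E"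
    by blast
qed

text \<open>
  Euler's integral restricted to \<open>{M..M + 1}\<close>. Since \<open>M\<close> is arbitrary, \<open>\<Gamma>\<close> grows faster
  than every exponential.
\<close>

lemma Gamma_ge_powr:
  fixes x M :: real
  assumes x: "x \<ge> 1" and M: "M > 0"
  shows "M powr (x - 1) * exp (- (M + 1)) \<le> Gamma x"
proof (rule has_integral_le)
  show "((\<lambda>t. if t \<in> {M..M + 1} then M powr (x - 1) * exp (- (M + 1)) else 0) has_integral
      M powr (x - 1) * exp (- (M + 1))) {0..}"
    using has_integral_restrict[of "{M..M + 1}" "{0..}"
        "\<lambda>_. M powr (x - 1) * exp (- (M + 1))" "M powr (x - 1) * exp (- (M + 1))"]
      has_integral_const_real[of "M powr (x - 1) * exp (- (M + 1))" M "M + 1"] M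
    by auto
  show "((\<lambda>t. t powr (x - 1) / exp t) has_integral Gamma x) {0..}"
    using x by (intro Gamma_integral_real) auto
  fix t :: real
  have "M powr (x - 1) * exp (- (M + 1)) \<le> t powr (x - 1) * exp (- t)" if "t \<in> {M..M + 1}"
    using that x M by (intro mult_mono powr_mono2) auto
  then show "(if t \<in> {M..M + 1} then M powr (x - 1) * exp (- (M + 1)) else 0) \<le>
      t powr (x - 1) / exp t"
    by (auto simp: exp_minus divide_inverse)
qed

text \<open>
  In the sector \<open>\<bar>y\<bar> \<le> K x\<close> with \<open>x \<ge> 1\<close>, the exponent \<open>y\<^sup>2 / 2 * (1 / x\<^sup>2 + 1 / x)\<close> is at
  most \<open>K\<^sup>2 / 2 * (1 + x)\<close>, hence linear in \<open>x\<close>. The lower bound for \<open>\<Gamma>\<close> on the real axis, with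
  \<open>M = exp (K\<^sup>2 / 2 + L)\<close>, absorbs it and leaves the rate \<open>L\<close>.
\<close>

lemma rGamma_decay_in_sector:
  fixes K L :: real
  obtains C where "\<And>z :: complex. Re z \<ge> 1 \<Longrightarrow> \<bar>Im z\<bar> \<le> K * Re z \<Longrightarrow>
    norm (rGamma z) \<le> C * exp (- L * Re z)"
proof -
  define l where "l = K\<^sup>2 / 2 + L"
  define C where "C = exp (K\<^sup>2 / 2 + l + exp l + 1)"
  have "norm (rGamma z) \<le> C * exp (- L * Re z)" if z: "Re z \<ge> 1" "\<bar>Im z\<bar> \<le> K * Re z" for z :: complex
  proof -
    define x where "x = Re z"
    have x: "x \<ge> 1"
      using z by (simp add: x_def)
    have "(Im z)\<^sup>2 \<le> (K * x)\<^sup>2"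
      using z by (metis abs_ge_zero power_mono power2_abs x_def)
    then have "(Im z)\<^sup>2 / 2 * (1 / x\<^sup>2 + 1 / x) \<le> (K * x)\<^sup>2 / 2 * (1 / x\<^sup>2 + 1 / x)"
      using x by (intro mult_right_mono divide_right_mono) auto
    also have "\<dots> = K\<^sup>2 / 2 * (1 + x)"
      using x by (simp add: field_simps power2_eq_square)
    finally have Im: "(Im z)\<^sup>2 / 2 * (1 / x\<^sup>2 + 1 / x) \<le> K\<^sup>2 / 2 * (1 + x)" .
    have "exp (l * (x - 1) - (exp l + 1)) \<le> Gamma x"
      using Gamma_ge_powr[OF x, of "exp l"] 
      by (simp add: powr_def exp_diff exp_minus field_simps exp_add)
    then have "inverse (Gamma x) \<le> inverse (exp (l * (x - 1) - (exp l + 1)))"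
      by (intro le_imp_inverse_le) auto
    then have real: "rGamma x \<le> exp ((exp l + 1) - l * (x - 1))"
      by (simp add: rGamma_inverse_Gamma flip: exp_minus)
    have "norm (rGamma z) \<le> rGamma x * exp ((Im z)\<^sup>2 / 2 * (1 / x\<^sup>2 + 1 / x))"
      using norm_rGamma_le_rGamma_Re[of z] x by (simp add: x_def)
    also have "\<dots> \<le> exp ((exp l + 1) - l * (x - 1)) * exp (K\<^sup>2 / 2 * (1 + x))"
      using Im real by (intro mult_mono) auto
    also have "\<dots> = C * exp (- L * x)"
      by (simp add: C_def l_def exp_add [symmetric] algebra_simps diff_divide_distrib add_divide_distrib)
    finally show ?thesis
      by (simp add: x_def)
  qed
  then show ?thesis
    by (rule that)
qed

section \<open>Convergence of the Prabhakar series\<close>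

text \<open>
  The points \<open>\<alpha> n + \<beta>\<close> lie in a common sector, and their real parts grow linearly. The decay rate
  \<open>L = ln (2 (r + 1)) / Re \<alpha>\<close> turns into the ratio \<open>1 / (2 (r + 1))\<close> per index, so that the series
  is eventually dominated by a multiple of \<open>\<Sum>n. (1 / 2) ^ n\<close>.
\<close>

lemma summable_norm_rGamma_affine:
  fixes \<alpha> \<beta> :: complex and r :: real
  assumes \<alpha>: "Re \<alpha> > 0" and \<beta>: "Re \<beta> > 0" and r: "r \<ge> 0"
  shows "summable (\<lambda>n. norm (rGamma (\<alpha> * of_nat n + \<beta>)) * r ^ n)"
proof -
  define a where "a = Re \<alpha>"
  define K where "K = \<bar>Im \<alpha>\<bar> / a + \<bar>Im \<beta>\<bar> / Re \<beta>"
  define L where "L = ln (2 * (r + 1)) / a"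
  have a: "a > 0" and L: "L \<ge> 0"
    using \<alpha> r by (auto simp: a_def L_def)
  obtain C where C: "\<And>z :: complex. Re z \<ge> 1 \<Longrightarrow> \<bar>Im z\<bar> \<le> K * Re z \<Longrightarrow>
      norm (rGamma z) \<le> C * exp (- L * Re z)"
    using rGamma_decay_in_sector by blast
  have "norm (rGamma (\<alpha> * of_nat n + \<beta>)) * r ^ n \<le> \<bar>C\<bar> * (1 / 2) ^ n" if n: "real n \<ge> 1 / a" for n
  proof -
    define w where "w = \<alpha> * of_nat n + \<beta>"
    have Re: "Re w = a * real n + Re \<beta>" and Im: "Im w = Im \<alpha> * real n + Im \<beta>"
      by (auto simp: w_def a_def)
    have "Re w \<ge> 1"
      using n a \<beta> by (simp add: Re field_simps)
    moreover have "\<bar>Im w\<bar> \<le> K * Re w"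
    proof -
      have "\<bar>Im w\<bar> \<le> \<bar>Im \<alpha>\<bar> * real n + \<bar>Im \<beta>\<bar>"
        unfolding Im by (rule order_trans[OF abs_triangle_ineq]) (simp add: abs_mult)
      also have "\<dots> = \<bar>Im \<alpha>\<bar> / a * (a * real n) + \<bar>Im \<beta>\<bar> / Re \<beta> * Re \<beta>"
        using a \<beta> by simp
      also have "\<dots> \<le> K * (a * real n) + K * Re \<beta>"
        using a \<beta> by (intro add_mono mult_right_mono) (auto simp: K_def)
      finally show ?thesis
        by (simp add: Re algebra_simps)
    qed
    ultimately have "norm (rGamma w) \<le> C * exp (- L * Re w)"
      by (rule C)
    also have "\<dots> \<le> \<bar>C\<bar> * exp (- L * (a * real n))"
      using L \<beta> by (intro mult_mono) (auto simp: Re algebra_simps)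
    also have "L * (a * real n) = real n * ln (2 * (r + 1))"
      using a by (simp add: L_def)
    then have "- L * (a * real n) = real n * (- ln (2 * (r + 1)))"
      by simp
    then have "exp (- L * (a * real n)) = (1 / (2 * (r + 1))) ^ n"
      using r by (simp only: exp_of_nat_mult exp_minus) (simp add: inverse_eq_divide)
    finally have "norm (rGamma w) * r ^ n \<le> \<bar>C\<bar> * (1 / (2 * (r + 1))) ^ n * r ^ n"
      using r by (intro mult_right_mono) auto
    also have "\<dots> = \<bar>C\<bar> * (r / (2 * (r + 1))) ^ n"
      by (simp add: power_divide)
    also have "\<dots> \<le> \<bar>C\<bar> * (1 / 2) ^ n"
      using r by (intro mult_left_mono power_mono) (auto simp: field_simps)
    finally show ?thesis
      by (simp add: w_def)
  qed
  then have "eventually (\<lambda>n. norm (norm (rGamma (\<alpha> * of_nat n + \<beta>)) * r ^ n) \<le> \<bar>C\<bar> * (1 / 2) ^ n)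
      sequentially"
    using r eventually_ge_at_top[of "nat \<lceil>1 / a\<rceil>"]
    by (auto simp: abs_mult elim!: eventually_mono)
  then show ?thesis
    by (rule summable_comparison_test_ev) (intro summable_mult summable_geometric, simp)
qed

lemma norm_pochhammer_div_fact_le:
  fixes c :: complex
  shows "norm (pochhammer c n / fact n) \<le> (norm c + 1) ^ n"
proof (induction n)
  case (Suc n)
  have "norm (c + of_nat n) \<le> norm c + real n"
    by (rule order_trans[OF norm_triangle_ineq]) simp
  also have "\<dots> \<le> (norm c + 1) * real (Suc n)"
    by (simp add: algebra_simps)
  finally have "norm (c + of_nat n) / real (Suc n) \<le> norm c + 1"
    by (simp add: divide_le_eq)
  then have "norm (pochhammer c n / fact n) * (norm (c + of_nat n) / real (Suc n))
      \<le> (norm c + 1) ^ n * (norm c + 1)"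
    by (intro mult_mono Suc.IH) auto
  also have "norm (pochhammer c n / fact n) * (norm (c + of_nat n) / real (Suc n)) =
      norm (pochhammer c (Suc n) / fact (Suc n))"
    by (simp add: pochhammer_Suc norm_mult norm_divide mult_ac del: of_nat_Suc)
  finally show ?case
    by (simp add: mult_ac)
qed simp

lemma summable_norm_prabhakar_ML:
  fixes \<alpha> \<beta> c z :: complex
  assumes "Re \<alpha> > 0" and "Re \<beta> > 0"
  shows "summable (\<lambda>n. norm (pochhammer c n / Gamma (\<alpha> * of_nat n + \<beta>) * (z ^ n / fact n)))"
proof (rule summable_comparison_test')
  show "summable (\<lambda>n. norm (rGamma (\<alpha> * of_nat n + \<beta>)) * ((norm c + 1) * norm z) ^ n)"
    using assms by (intro summable_norm_rGamma_affine) auto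
  fix n :: nat
  have "norm (pochhammer c n / Gamma (\<alpha> * of_nat n + \<beta>) * (z ^ n / fact n)) =
      norm (rGamma (\<alpha> * of_nat n + \<beta>)) * (norm (pochhammer c n / fact n) * norm z ^ n)"
    by (simp add: Gamma_def norm_mult norm_divide norm_inverse norm_power field_simps)
  also have "\<dots> \<le> norm (rGamma (\<alpha> * of_nat n + \<beta>)) * ((norm c + 1) ^ n * norm z ^ n)"
    by (intro mult_left_mono mult_right_mono norm_pochhammer_div_fact_le) auto
  finally show "norm (norm (pochhammer c n / Gamma (\<alpha> * of_nat n + \<beta>) * (z ^ n / fact n))) \<le>
      norm (rGamma (\<alpha> * of_nat n + \<beta>)) * ((norm c + 1) * norm z) ^ n"
    by (simp add: power_mult_distrib)
qed

section \<open>Integration of power series against the extended beta weight\<close>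

text \<open>
  On the unit interval \<open>\<bar>t ^ n\<bar> \<le> 1\<close>, so the \<open>n\<close>-th term is dominated by \<open>\<bar>a n\<bar> * \<bar>w t\<bar>\<close>.
\<close>

lemma set_integral_power_series_sums:
  fixes w :: "real \<Rightarrow> complex" and a :: "nat \<Rightarrow> complex"
  assumes w: "set_integrable lborel {0<..<1} w" and a: "summable (\<lambda>n. norm (a n))"
  shows "(\<lambda>n. a n * (LINT t:{0<..<1}|lborel. of_real t ^ n * w t)) sums
           (LINT t:{0<..<1}|lborel. w t * (\<Sum>n. a n * of_real t ^ n))"
proof -
  define v where "v t = indicat_real {0<..<1} t *\<^sub>R w t" for t
  define f where "f n t = a n * (of_real t ^ n * v t)" for n t
  have v: "integrable lborel v"
    using w by (simp add: v_def[abs_def] set_integrable_def)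
  have norm_le: "norm (f n t) \<le> norm (a n) * norm (v t)" for n t
  proof (cases "t \<in> {0<..<1}")
    case True
    then have "norm (of_real t ^ n * v t) \<le> 1 * norm (v t)"
      unfolding norm_mult norm_power by (intro mult_right_mono power_le_one) auto
    then show ?thesis
      unfolding f_def norm_mult[of "a n"] by (intro mult_left_mono) auto
  qed (simp add: f_def v_def)
  have f: "integrable lborel (f n)" for n
  proof (rule Bochner_Integration.integrable_bound)
    show "integrable lborel (\<lambda>t. norm (a n) * norm (v t))"
      using v by auto
    show "f n \<in> borel_measurable lborel"
      unfolding f_def[abs_def] using borel_measurable_integrable[OF v] by measurable
  qed (use norm_le in auto)
  have "(\<lambda>n. integral\<^sup>L lborel (f n)) sums (LINT t|lborel. (\<Sum>n. f n t))"
  proof (rule sums_integral[OF f])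
    show "AE t in lborel. summable (\<lambda>n. norm (f n t))"
      using norm_le a
      by (intro AE_I2 summable_comparison_test'[OF summable_mult2[OF a]]) auto
    have "integral\<^sup>L lborel (\<lambda>t. norm (f n t)) \<le> norm (a n) * integral\<^sup>L lborel (\<lambda>t. norm (v t))" for n
      using integral_mono[of lborel "\<lambda>t. norm (f n t)" "\<lambda>t. norm (a n) * norm (v t)"] f v norm_le
      by auto
    then show "summable (\<lambda>n. integral\<^sup>L lborel (\<lambda>t. norm (f n t)))"
      by (intro summable_comparison_test'[OF summable_mult2[OF a]]) auto
  qed
  moreover have "integral\<^sup>L lborel (f n) = a n * (LINT t:{0<..<1}|lborel. of_real t ^ n * w t)" for n
  proof -
    have "integral\<^sup>L lborel (f n) = a n * (LINT t|lborel. of_real t ^ n * v t)"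
      by (simp add: f_def[abs_def])
    then show ?thesis
      by (simp add: v_def set_lebesgue_integral_def)
  qed
  moreover have "(LINT t|lborel. (\<Sum>n. f n t)) =
      (LINT t:{0<..<1}|lborel. w t * (\<Sum>n. a n * of_real t ^ n))"
    unfolding set_lebesgue_integral_def
  proof (intro Bochner_Integration.integral_cong refl)
    fix t :: real
    show "(\<Sum>n. f n t) = indicat_real {0<..<1} t *\<^sub>R (w t * (\<Sum>n. a n * of_real t ^ n))"
    proof (cases "t \<in> {0<..<1}")
      case True
      then have "norm (a n * of_real t ^ n) \<le> norm (a n)" for n
        by (auto simp: norm_mult norm_power intro!: mult_left_le power_le_one)
      then have "summable (\<lambda>n. a n * of_real t ^ n)"
        by (intro summable_comparison_test'[OF a]) auto
      then show ?thesis
        using True suminf_mult[of "\<lambda>n. a n * of_real t ^ n" "w t"]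
        by (simp add: f_def v_def mult_ac)
    qed (simp add: f_def v_def)
  qed
  ultimately show ?thesis
    by simp
qed

text \<open>The assumptions \<open>p \<ge> 0\<close> and \<open>q \<ge> 0\<close> bound the exponential factor by \<open>1\<close>.\<close>

lemma set_integrable_ext_Beta:
  fixes x y :: complex and p q :: real
  assumes x: "Re x > 0" and y: "Re y > 0" and p: "p \<ge> 0" and q: "q \<ge> 0"
  shows "set_integrable lborel {0<..<1} (\<lambda>t. complex_of_real t powr (x - 1) *
           complex_of_real (1 - t) powr (y - 1) * complex_of_real (exp (- (p / t) - q / (1 - t))))"
proof (rule set_integrable_bound)
  show "set_integrable lborel {0<..<1} (\<lambda>t. t powr (Re x - 1) * (1 - t) powr (Re y - 1))"
    by (rule set_integrable_subset[OF integrable_Beta[OF x y]]) auto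
  show "set_borel_measurable lborel {0<..<1} (\<lambda>t. complex_of_real t powr (x - 1) *
      complex_of_real (1 - t) powr (y - 1) * complex_of_real (exp (- (p / t) - q / (1 - t))))"
    unfolding set_borel_measurable_def measurable_lborel1 measurable_lborel2
    by (rule borel_measurable_continuous_on_indicator) 
       (auto intro!: continuous_intros simp: complex_nonpos_Reals_iff)
  show "AE t in lborel. t \<in> {0<..<1} \<longrightarrow>
      norm (complex_of_real t powr (x - 1) * complex_of_real (1 - t) powr (y - 1) *
        complex_of_real (exp (- (p / t) - q / (1 - t)))) \<le>
      norm (t powr (Re x - 1) * (1 - t) powr (Re y - 1))"
  proof (intro AE_I2 impI)
    fix t :: real
    assume t: "t \<in> {0<..<1}"
    then have "p / t \<ge> 0" and "q / (1 - t) \<ge> 0"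
      using p q by auto
    then have "exp (- (p / t) - q / (1 - t)) \<le> 1"
      by simp
    moreover have "norm (complex_of_real t powr (x - 1)) = t powr (Re x - 1)"
      "norm (complex_of_real (1 - t) powr (y - 1)) = (1 - t) powr (Re y - 1)"
      using t norm_powr_real_powr[of "complex_of_real t" "x - 1"]
        norm_powr_real_powr[of "complex_of_real (1 - t)" "y - 1"]
      by (simp_all del: of_real_diff)
    ultimately show "norm (complex_of_real t powr (x - 1) * complex_of_real (1 - t) powr (y - 1) *
        complex_of_real (exp (- (p / t) - q / (1 - t)))) \<le>
        norm (t powr (Re x - 1) * (1 - t) powr (Re y - 1))"
      by (simp add: norm_mult mult_left_le abs_mult del: of_real_diff)
  qed
qed

lemma ext_Beta_add_of_nat:
  "ext_Beta (x + of_nat n) y p q =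
     (LINT t:{0<..<1}|lborel. of_real t ^ n * (complex_of_real t powr (x - 1) *
        complex_of_real (1 - t) powr (y - 1) * complex_of_real (exp (- (p / t) - q / (1 - t)))))"
  unfolding ext_Beta_def
proof (rule set_lebesgue_integral_cong, simp, intro allI impI)
  fix t :: real
  assume "t \<in> {0<..<1}"
  then have "complex_of_real t powr (x + of_nat n - 1) = complex_of_real t powr (x - 1) * of_real t ^ n"
    using powr_add[of "complex_of_real t" "x - 1" "of_nat n"]
    by (simp add: powr_nat' algebra_simps)
  then show "complex_of_real t powr (x + of_nat n - 1) * complex_of_real (1 - t) powr (y - 1) *
      complex_of_real (exp (- (p / t) - q / (1 - t))) =
      of_real t ^ n * (complex_of_real t powr (x - 1) *
        complex_of_real (1 - t) powr (y - 1) * complex_of_real (exp (- (p / t) - q / (1 - t))))"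
    by (simp add: mult_ac)
qed

theorem theorem2p1:
  fixes c \<alpha> \<beta> \<gamma> z :: complex and p q :: real
  assumes "Re c > Re \<gamma>" and "Re \<gamma> > 0" and "Re \<alpha> > 0" and "Re \<beta> > 0"
    and "p \<ge> 0" and "q \<ge> 0"
  shows "ext_ML \<alpha> \<beta> \<gamma> c z p q =
    1 / Beta \<gamma> (c - \<gamma>) *
    (LINT t:{0<..<1}|lborel.
       complex_of_real t powr (\<gamma> - 1) * complex_of_real (1 - t) powr (c - \<gamma> - 1) *
       complex_of_real (exp (- (p / t) - q / (1 - t))) *
       prabhakar_ML \<alpha> \<beta> c (complex_of_real t * z))"
proof -
  define w where "w t = complex_of_real t powr (\<gamma> - 1) * complex_of_real (1 - t) powr (c - \<gamma> - 1) *
       complex_of_real (exp (- (p / t) - q / (1 - t)))" for t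
  define a where "a n = pochhammer c n / Gamma (\<alpha> * of_nat n + \<beta>) * (z ^ n / fact n)" for n
  have w: "set_integrable lborel {0<..<1} w"
    unfolding w_def[abs_def] using assms by (intro set_integrable_ext_Beta) auto
  have a: "summable (\<lambda>n. norm (a n))"
    unfolding a_def using assms by (intro summable_norm_prabhakar_ML)
  have series: "prabhakar_ML \<alpha> \<beta> c (complex_of_real t * z) = (\<Sum>n. a n * of_real t ^ n)" for t
    by (simp add: prabhakar_ML_def a_def power_mult_distrib mult_ac)
  have "(\<lambda>n. 1 / Beta \<gamma> (c - \<gamma>) * (a n * ext_Beta (\<gamma> + of_nat n) (c - \<gamma>) p q)) sums
      (1 / Beta \<gamma> (c - \<gamma>) *
        (LINT t:{0<..<1}|lborel. w t * prabhakar_ML \<alpha> \<beta> c (complex_of_real t * z)))"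
    unfolding series ext_Beta_add_of_nat
    using set_integral_power_series_sums[OF w a] by (intro sums_mult) (simp add: w_def)
  then show ?thesis
    by (simp add: ext_ML_def a_def w_def sums_iff mult_ac)
qed

end
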